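(* For each integer $n\neq0$, there exists a map $\varphi'_n:\mathbb{R}\mathrm{P}^3\to S^2$ in the homotopy class $[h'_n]$ such that $(\varphi'_n)^{-1}(y_0)$ is a circle (i.e. is homeomorphic to $S^1$).
   Context: "Map" means continuous map, and $[f]$ is the homotopy class of $f$. Hopf fibration: $S^3=\{(z_1,z_2)\in\mathbb{C}^2 : |z_1|^2+|z_2|^2=1\}$; the circle $S^1$ acts by $(\lambda,(z_1,z_2))\mapsto(\lambda z_1,\lambda z_2)$; $S^1(z_1,z_2)$ is the orbit of $(z_1,z_2)$; the orbit space $S^3/S^1=\mathbb{C}\mathrm{P}^1$ is identified with $S^2$; and $h:S^3\to S^2$ is $h(z_1,z_2)=[S^1(z_1,z_2)]$. The base point is $y_0=h(1,0)\in S^2$. The group $\pi_3(S^2)\approx\mathbb{Z}$ is generated by $[h]$, and $nh:S^3\to S^2$ denotes a map in the class $n[h]$ (the composite of a self-map of $S^3$ of degree $n$ with $h$). Projective space: points of $\mathbb{R}\mathrm{P}^3$ are written $[z_1,z_2]$, the image of $(z_1,z_2)\in S^3$ under the double covering $\mathfrak{p}_3:S^3\to\mathbb{R}\mathrm{P}^3$ identifying antipodal points. $\mathfrak{q}_3:\mathbb{R}\mathrm{P}^3\to\mathbb{R}\mathrm{P}^3/\mathbb{R}\mathrm{P}^2\cong S^3$ is the map collapsing the $2$-skeleton $\mathbb{R}\mathrm{P}^2\subset\mathbb{R}\mathrm{P}^3$ to a point, with orientations chosen so that $\deg\mathfrak{q}_3=1$ and $\mathfrak{q}_3\circ\mathfrak{p}_3$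 has degree $2$. The maps $h'_n:\mathbb{R}\mathrm{P}^3\to S^2$, $n\in\mathbb{Z}$: let $h':\mathbb{R}\mathrm{P}^3\to S^2$ be $h'([z_1,z_2])=[S^1(z_1,z_2)]$. For $k$ odd, let $\mathfrak{a}_k:S^3\to S^3$ be $\mathfrak{a}_k(z_1,z_2)=(z_1^k,z_2)/|(z_1^k,z_2)|$, a map of degree $k$ (for $k<0$, $z_1^k$ is understood as $\overline{z_1}^{\,|k|}$), let $\mathfrak{a}'_k:\mathbb{R}\mathrm{P}^3\to\mathbb{R}\mathrm{P}^3$ be the induced map $\mathfrak{a}'_k([z_1,z_2])=[\mathfrak{a}_k(z_1,z_2)]$, and set $h'_k=h'\circ\mathfrak{a}'_k$. For even indices set $h'_{2n}=nh\circ\mathfrak{q}_3$ for $n\in\mathbb{Z}$ ($h'_0$ is taken to be a constant map). *)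

theory Defs
  imports "HOL-Homology.Homology"
begin

text \<open>The finest topology on \<open>f ` topspace X\<close> that makes \<open>f\<close> continuous.\<close>

definition quotient_topology :: "'a topology \<Rightarrow> ('a \<Rightarrow> 'b) \<Rightarrow> 'b topology" where
  "quotient_topology X f =
     topology (\<lambda>U. U \<subseteq> f ` topspace X \<and> openin X {x \<in> topspace X. f x \<in> U})"

lemma openin_quotient_topology:
  "openin (quotient_topology X f) U \<longleftrightarrow>
     U \<subseteq> f ` topspace X \<and> openin X {x \<in> topspace X. f x \<in> U}"
proof -
  have "istopology (\<lambda>U. U \<subseteq> f ` topspace X \<and> openin X {x \<in> topspace X. f x \<in> U})"
    unfolding istopology_def
  proof (intro conjI allI impI)
    fix S T
    assume S: "S \<subseteq> f ` topspace X \<and> openin X {x \<in> topspace X. f x \<in> S}"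
      and T: "T \<subseteq> f ` topspace X \<and> openin X {x \<in> topspace X. f x \<in> T}"
    show "S \<inter> T \<subseteq> f ` topspace X" using S by blast
    have "{x \<in> topspace X. f x \<in> S \<inter> T} =
        {x \<in> topspace X. f x \<in> S} \<inter> {x \<in> topspace X. f x \<in> T}" by blast
    then show "openin X {x \<in> topspace X. f x \<in> S \<inter> T}" using S T by (simp only: openin_Int)
  next
    fix \<K>
    assume K: "\<forall>U\<in>\<K>. U \<subseteq> f ` topspace X \<and> openin X {x \<in> topspace X. f x \<in> U}"
    show "\<Union>\<K> \<subseteq> f ` topspace X" using K by blast
    have "{x \<in> topspace X. f x \<in> \<Union>\<K>} = (\<Union>U\<in>\<K>. {x \<in> topspace X. f x \<in> U})" by blast
    then show "openin X {x \<in> topspace X. f x \<in> \<Union>\<K>}" using K by auto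
  qed
  then show ?thesis by (simp add: quotient_topology_def)
qed

lemma topspace_quotient_topology [simp]: "topspace (quotient_topology X f) = f ` topspace X"
proof -
  have "{x \<in> topspace X. f x \<in> f ` topspace X} = topspace X" by blast
  then have "openin (quotient_topology X f) (f ` topspace X)"
    by (simp add: openin_quotient_topology)
  then show ?thesis
    by (meson openin_quotient_topology openin_subset openin_topspace subset_antisym)
qed

lemma quotient_map_quotient_topology: "quotient_map X (quotient_topology X f) f"
  by (auto simp: quotient_map_def openin_quotient_topology)

definition S3 :: "(complex \<times> complex) topology" where
  "S3 = top_of_set {(z1, z2). (cmod z1)\<^sup>2 + (cmod z2)\<^sup>2 = 1}"

definition S1_orbit :: "complex \<times> complex \<Rightarrow> (complex \<times> complex) set" where
  "S1_orbit z = {(l * fst z, l * snd z) | l. cmod l = 1}"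

text \<open>\<open>S\<^sup>2\<close> is the orbit space \<open>S\<^sup>3 / S\<^sup>1 = \<complex>P\<^sup>1\<close>; its points are the orbits themselves.
  The lemma \<open>S2_homeomorphic_sphere\<close> below identifies it with the round sphere.\<close>

definition S2 :: "(complex \<times> complex) set topology" where
  "S2 = quotient_topology S3 S1_orbit"

definition hopf :: "complex \<times> complex \<Rightarrow> (complex \<times> complex) set" where
  "hopf z = S1_orbit z"

definition y0 :: "(complex \<times> complex) set" where
  "y0 = hopf (1, 0)"

lemma topspace_S3: "topspace S3 = {(z1, z2). (cmod z1)\<^sup>2 + (cmod z2)\<^sup>2 = 1}"
  by (simp add: S3_def)

lemma S1_orbit_eq_iff:
  assumes "z \<in> topspace S3" "w \<in> topspace S3"
  shows "S1_orbit z = S1_orbit w \<longleftrightarrow>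
    (2 * fst z * cnj (snd z), (cmod (fst z))\<^sup>2 - (cmod (snd z))\<^sup>2) =
    (2 * fst w * cnj (snd w), (cmod (fst w))\<^sup>2 - (cmod (snd w))\<^sup>2)"
    (is "?L \<longleftrightarrow> ?R")
proof
  assume ?L
  moreover have "w \<in> S1_orbit w"
    unfolding S1_orbit_def by (rule CollectI, rule exI[of _ 1]) simp
  ultimately have "w \<in> S1_orbit z" by simp
  then obtain l where l: "cmod l = 1" "fst w = l * fst z" "snd w = l * snd z"
    by (auto simp: S1_orbit_def)
  have "l * cnj l = 1" using l(1) by (simp add: complex_norm_square[symmetric])
  then have "2 * fst w * cnj (snd w) = 2 * fst z * cnj (snd z)"
    by (simp add: l(2,3) mult.commute mult.left_commute)
  then show ?R using l by (simp add: norm_mult)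
next
  assume R: ?R
  obtain a b c d where zw: "z = (a, b)" "w = (c, d)" by (metis surj_pair)
  have n: "(cmod a)\<^sup>2 + (cmod b)\<^sup>2 = 1" "(cmod c)\<^sup>2 + (cmod d)\<^sup>2 = 1"
    using assms by (simp_all add: zw topspace_S3)
  have e: "a * cnj b = c * cnj d" and d: "(cmod a)\<^sup>2 - (cmod b)\<^sup>2 = (cmod c)\<^sup>2 - (cmod d)\<^sup>2"
    using R by (simp_all add: zw mult.assoc)
  have ac: "(cmod a)\<^sup>2 = (cmod c)\<^sup>2" and bd: "(cmod b)\<^sup>2 = (cmod d)\<^sup>2" using n d by linarith+
  have ac': "a * cnj a = c * cnj c" and bd': "b * cnj b = d * cnj d"
    using ac bd by (simp_all add: complex_norm_square[symmetric])
  have n': "a * cnj a + b * cnj b = 1" "c * cnj c + d * cnj d = 1"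
    using n by (metis complex_norm_square of_real_add of_real_1)+
  have e': "b * cnj a = d * cnj c" using arg_cong[OF e, of cnj] by (simp add: mult.commute)
  define l where "l = c * cnj a + d * cnj b"
  have c: "c = l * a"
  proof -
    have "l * a = c * (a * cnj a) + d * (a * cnj b)" by (simp add: l_def algebra_simps)
    also have "\<dots> = c * (c * cnj c) + d * (c * cnj d)" by (simp add: e ac')
    also have "\<dots> = c * (c * cnj c + d * cnj d)" by (simp add: algebra_simps)
    finally show ?thesis by (simp add: n')
  qed
  have d': "d = l * b"
  proof -
    have "l * b = c * (b * cnj a) + d * (b * cnj b)" by (simp add: l_def algebra_simps)
    also have "\<dots> = c * (d * cnj c) + d * (d * cnj d)" by (simp add: e' bd')
    also have "\<dots> = d * (c * cnj c + d * cnj d)" by (simp add: algebra_simps)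
    finally show ?thesis by (simp add: n')
  qed
  have "(cmod l)\<^sup>2 * ((cmod a)\<^sup>2 + (cmod b)\<^sup>2) = (cmod c)\<^sup>2 + (cmod d)\<^sup>2"
    by (simp add: c d' norm_mult power_mult_distrib distrib_left)
  then have "(cmod l)\<^sup>2 = 1\<^sup>2" using n by simp
  then have l1: "cmod l = 1" by (rule power2_eq_imp_eq) simp_all
  then have l0: "l \<noteq> 0" by auto
  show ?L
  proof
    show "S1_orbit z \<subseteq> S1_orbit w"
    proof
      fix x assume "x \<in> S1_orbit z"
      then obtain m where m: "cmod m = 1" "x = (m * a, m * b)" by (auto simp: S1_orbit_def zw)
      then have "cmod (m / l) = 1" "x = (m / l * c, m / l * d)"
        using l0 l1 by (simp_all add: c d' norm_divide)
      then show "x \<in> S1_orbit w"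
        unfolding S1_orbit_def zw by (intro CollectI exI[of _ "m / l"]) simp
    qed
    show "S1_orbit w \<subseteq> S1_orbit z"
    proof
      fix x assume "x \<in> S1_orbit w"
      then obtain m where m: "cmod m = 1" "x = (m * c, m * d)" by (auto simp: S1_orbit_def zw)
      then have "cmod (m * l) = 1" "x = (m * l * a, m * l * b)"
        using l1 by (simp_all add: c d' norm_mult)
      then show "x \<in> S1_orbit z"
        unfolding S1_orbit_def zw by (intro CollectI exI[of _ "m * l"]) simp
    qed
  qed
qed

lemma S2_homeomorphic_sphere: "S2 homeomorphic_space top_of_set (sphere (0 :: complex \<times> real) 1)"
proof -
  define H :: "complex \<times> complex \<Rightarrow> complex \<times> real" where
    "H z = (2 * fst z * cnj (snd z), (cmod (fst z))\<^sup>2 - (cmod (snd z))\<^sup>2)" for z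
  let ?T = "top_of_set (sphere (0 :: complex \<times> real) 1)"
  have S3s: "{(z1, z2). (cmod z1)\<^sup>2 + (cmod z2)\<^sup>2 = 1} = sphere (0 :: complex \<times> complex) 1"
    by (auto simp: norm_prod_def sphere_def dist_norm)
  have HS: "H z \<in> sphere 0 1" if "z \<in> topspace S3" for z
  proof -
    obtain a b where z: "z = (a, b)" by (metis surj_pair)
    have "(cmod a)\<^sup>2 + (cmod b)\<^sup>2 = 1" using that by (simp add: z topspace_S3)
    moreover have "(2 * cmod a * cmod b)\<^sup>2 + ((cmod a)\<^sup>2 - (cmod b)\<^sup>2)\<^sup>2 = ((cmod a)\<^sup>2 + (cmod b)\<^sup>2)\<^sup>2"
      by (simp add: power2_eq_square algebra_simps)
    ultimately show ?thesis by (simp add: H_def z norm_prod_def norm_mult)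
  qed
  have surj: "H ` topspace S3 = sphere 0 1"
  proof
    show "H ` topspace S3 \<subseteq> sphere 0 1" using HS by blast
    show "sphere 0 1 \<subseteq> H ` topspace S3"
    proof
      fix y :: "complex \<times> real" assume "y \<in> sphere 0 1"
      then obtain u t where y: "y = (u, t)" "(cmod u)\<^sup>2 + t\<^sup>2 = 1"
        by (cases y) (auto simp: norm_prod_def)
      show "y \<in> H ` topspace S3"
      proof (cases "t = -1")
        case True
        then have "y = H (0, 1)" using y by (simp add: H_def)
        moreover have "(0, 1) \<in> topspace S3" by (simp add: topspace_S3)
        ultimately show ?thesis by blast
      next
        case False
        have "t\<^sup>2 \<le> 1" using y(2) by (metis add.commute le_add_same_cancel1 zero_le_power2)
        then have "\<bar>t\<bar> \<le> 1" by (simp add: abs_square_le_1)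
        then have t: "1 + t > 0" using False by linarith
        define r where "r = sqrt ((1 + t) / 2)"
        have r: "r > 0" "r\<^sup>2 = (1 + t) / 2" using t by (simp_all add: r_def)
        define z where "z = (complex_of_real r, cnj u / (2 * complex_of_real r))"
        have "(cmod u)\<^sup>2 / (4 * r\<^sup>2) = (1 - t) / 2"
        proof -
          have "(cmod u)\<^sup>2 = (1 - t) * (1 + t)" using y(2) by (simp add: power2_eq_square algebra_simps)
          then show ?thesis using t by (simp add: r(2) field_simps)
        qed
        then have b: "(cmod (snd z))\<^sup>2 = (1 - t) / 2"
          using r(1) by (simp add: z_def norm_divide norm_mult power_divide power_mult_distrib)
        have a: "(cmod (fst z))\<^sup>2 = (1 + t) / 2" using r by (simp add: z_def)
        have "z \<in> topspace S3" using a b by (simp add: topspace_S3 case_prod_beta add_divide_distrib[symmetric])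
        moreover have "H z = y"
          using a b r by (simp add: H_def y) (simp add: z_def field_simps)
        ultimately show ?thesis by blast
      qed
    qed
  qed
  have "continuous_on (sphere 0 1) H"
    unfolding H_def by (intro continuous_intros)
  then have cont: "continuous_map S3 ?T H"
    using HS by (auto simp: S3_def S3s)
  have "compact_space S3"
    by (simp add: S3_def S3s compact_space_subtopology)
  moreover have "Hausdorff_space ?T"
    by (simp add: Hausdorff_space_subtopology)
  ultimately have qH: "quotient_map S3 ?T H"
    using cont surj by (intro T1_Spaces.continuous_imp_quotient_map) simp_all
  have qO: "quotient_map S3 S2 S1_orbit"
    unfolding S2_def by (rule quotient_map_quotient_topology)
  have iff: "S1_orbit z = S1_orbit w \<longleftrightarrow> H z = H w"
    if "z \<in> topspace S3" "w \<in> topspace S3" for z w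
    using S1_orbit_eq_iff[OF that] by (simp add: H_def)
  obtain f where f: "continuous_map S2 ?T f" "\<And>x. x \<in> topspace S3 \<Longrightarrow> f (S1_orbit x) = H x"
    by (rule quotient_map_lift_exists[OF qO cont]) (simp_all add: iff)
  obtain g where g: "continuous_map ?T S2 g" "\<And>x. x \<in> topspace S3 \<Longrightarrow> g (H x) = S1_orbit x"
    by (rule quotient_map_lift_exists[OF qH quotient_imp_continuous_map[OF qO]])
      (simp_all add: iff)
  have "homeomorphic_maps S2 ?T f g"
    unfolding homeomorphic_maps_def
  proof (intro conjI ballI f(1) g(1))
    fix x assume "x \<in> topspace S2"
    then show "g (f x) = x" using f(2) g(2) by (auto simp: S2_def)
  next
    fix y assume "y \<in> topspace ?T"
    then have "y \<in> H ` topspace S3" using surj by simp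
    then show "f (g y) = y" using f(2) g(2) by auto
  qed
  then show ?thesis by (auto simp: homeomorphic_space_def)
qed

text \<open>The Brouwer degree of the library concerns self-maps of \<open>nsphere 3\<close>, whose points are
  functions \<open>nat \<Rightarrow> real\<close> supported on \<open>{0..3}\<close>. Degrees of self-maps of \<open>S3\<close> are taken after
  conjugation with the evident homeomorphism.\<close>

definition S3_to_nsphere :: "complex \<times> complex \<Rightarrow> nat \<Rightarrow> real" where
  "S3_to_nsphere z = (\<lambda>i. if i = 0 then Re (fst z) else if i = 1 then Im (fst z)
     else if i = 2 then Re (snd z) else if i = 3 then Im (snd z) else 0)"

definition nsphere_to_S3 :: "(nat \<Rightarrow> real) \<Rightarrow> complex \<times> complex" where
  "nsphere_to_S3 x = (Complex (x 0) (x 1), Complex (x 2) (x 3))"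

definition S3_degree :: "(complex \<times> complex \<Rightarrow> complex \<times> complex) \<Rightarrow> int" where
  "S3_degree f = Brouwer_degree2 3 (S3_to_nsphere \<circ> f \<circ> nsphere_to_S3)"

lemma homeomorphic_maps_S3_nsphere: "homeomorphic_maps S3 (nsphere 3) S3_to_nsphere nsphere_to_S3"
  unfolding homeomorphic_maps_def
proof (intro conjI ballI)
  have *: "continuous_on UNIV (\<lambda>z. S3_to_nsphere z i)" for i
  proof -
    consider "i = 0" | "i = 1" | "i = 2" | "i = 3" | "i > 3" by linarith
    then show ?thesis
      by cases (auto simp: S3_to_nsphere_def intro!: continuous_intros)
  qed
  have sum4: "(\<Sum>i\<le>3. (x i)\<^sup>2) = (x 0)\<^sup>2 + (x 1)\<^sup>2 + (x 2)\<^sup>2 + (x 3)\<^sup>2" for x :: "nat \<Rightarrow> real"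
    by (simp add: eval_nat_numeral)
  show "continuous_map S3 (nsphere 3) S3_to_nsphere"
    unfolding nsphere continuous_map_in_subtopology continuous_map_componentwise_UNIV sum4
  proof (intro conjI allI)
    show "continuous_map S3 euclideanreal (\<lambda>z. S3_to_nsphere z k)" for k
      using * continuous_on_subset by (force simp: S3_def)
    show "S3_to_nsphere \<in> topspace S3 \<rightarrow>
        {x. (x 0)\<^sup>2 + (x 1)\<^sup>2 + (x 2)\<^sup>2 + (x 3)\<^sup>2 = 1 \<and> (\<forall>i>3. x i = 0)}"
      by (auto simp: topspace_S3 S3_to_nsphere_def cmod_power2)
  qed
  have p: "continuous_map (nsphere 3) euclideanreal (\<lambda>x. x i)" for i
    unfolding nsphere
    by (intro continuous_map_from_subtopology continuous_map_product_projection) auto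
  have C: "nsphere_to_S3 = (\<lambda>x. (of_real (x 0) + \<i> * of_real (x 1), of_real (x 2) + \<i> * of_real (x 3)))"
    by (auto simp: nsphere_to_S3_def fun_eq_iff Complex_eq)
  have lim: "continuous_map (nsphere 3) euclidean (\<lambda>x. of_real (x i) + \<i> * of_real (x j))" for i j
  proof -
    have "continuous_map (nsphere 3) euclidean ((\<lambda>(a::real, b::real). of_real a + \<i> * of_real b) \<circ> (\<lambda>x. (x i, x j)))"
    proof (rule continuous_map_compose)
      show "continuous_map (nsphere 3) (euclidean :: (real \<times> real) topology) (\<lambda>x. (x i, x j))"
        unfolding prod_topology_euclidean[symmetric]
        by (intro continuous_map_pairedI p)
      show "continuous_map euclidean euclidean (\<lambda>(a::real, b::real). complex_of_real a + \<i> * of_real b)"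
        by (auto simp: case_prod_beta intro!: continuous_intros)
    qed
    then show ?thesis by (simp add: o_def)
  qed
  show "continuous_map (nsphere 3) S3 nsphere_to_S3"
    unfolding S3_def continuous_map_in_subtopology
  proof
    show "continuous_map (nsphere 3) euclidean nsphere_to_S3"
      unfolding C prod_topology_euclidean[symmetric]
      by (intro continuous_map_pairedI lim)
    show "nsphere_to_S3 \<in> topspace (nsphere 3) \<rightarrow> {(z1, z2). (cmod z1)\<^sup>2 + (cmod z2)\<^sup>2 = 1}"
      by (auto simp: nsphere sum4 nsphere_to_S3_def cmod_power2)
  qed
  show "nsphere_to_S3 (S3_to_nsphere z) = z" for z
    by (simp add: nsphere_to_S3_def S3_to_nsphere_def)
  show "S3_to_nsphere (nsphere_to_S3 x) = x" if "x \<in> topspace (nsphere 3)" for x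
  proof
    fix i :: nat
    consider "i = 0" | "i = 1" | "i = 2" | "i = 3" | "i > 3" by linarith
    then show "S3_to_nsphere (nsphere_to_S3 x) i = x i"
      using that by cases (auto simp: nsphere_to_S3_def S3_to_nsphere_def nsphere)
  qed
qed

text \<open>\<open>p3 (z1, z2)\<close> is the point \<open>[z1, z2]\<close> of projective space, as the pair of antipodes.\<close>

definition p3 :: "complex \<times> complex \<Rightarrow> (complex \<times> complex) set" where
  "p3 z = {z, - z}"

definition RP3 :: "(complex \<times> complex) set topology" where
  "RP3 = quotient_topology S3 p3"

text \<open>In real coordinates \<open>z1 = x0 + i x1\<close>, \<open>z2 = x2 + i x3\<close>, the standard 2-skeleton is
  \<open>x3 = 0\<close>.\<close>

definition RP2 :: "(complex \<times> complex) set set" where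
  "RP2 = p3 ` {z \<in> topspace S3. Im (snd z) = 0}"

definition RP3_collapse :: "(complex \<times> complex) set \<Rightarrow> (complex \<times> complex) set set" where
  "RP3_collapse P = (if P \<in> RP2 then RP2 else {P})"

definition RP3_mod_RP2 :: "(complex \<times> complex) set set topology" where
  "RP3_mod_RP2 = quotient_topology RP3 RP3_collapse"

text \<open>\<open>q\<close> is the collapse map followed by some identification of \<open>\<real>P\<^sup>3 / \<real>P\<^sup>2\<close> with \<open>S\<^sup>3\<close>.
  With \<open>\<real>P\<^sup>3\<close> oriented so that the double covering has degree 2, the normalisation \<open>deg q = 1\<close>
  is the condition on \<open>q \<circ> p3\<close>.\<close>

definition is_q3 :: "((complex \<times> complex) set \<Rightarrow> complex \<times> complex) \<Rightarrow> bool" where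
  "is_q3 q \<longleftrightarrow>
     (\<exists>\<theta>. homeomorphic_map RP3_mod_RP2 S3 \<theta> \<and>
          (\<forall>P \<in> topspace RP3. q P = \<theta> (RP3_collapse P))) \<and>
     S3_degree (q \<circ> p3) = 2"

definition homotopy_class :: "'a topology \<Rightarrow> 'b topology \<Rightarrow> ('a \<Rightarrow> 'b) \<Rightarrow> ('a \<Rightarrow> 'b) set" where
  "homotopy_class X Y f = {g. homotopic_with (\<lambda>_. True) X Y f g}"

definition zpow :: "int \<Rightarrow> complex \<Rightarrow> complex" where
  "zpow k z = (if k \<ge> 0 then z ^ nat k else cnj z ^ nat (- k))"

text \<open>The norm on \<open>\<complex> \<times> \<complex>\<close> is the Euclidean one.\<close>

definition a_map :: "int \<Rightarrow> complex \<times> complex \<Rightarrow> complex \<times> complex" where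
  "a_map k z = (1 / norm (zpow k (fst z), snd z)) *\<^sub>R (zpow k (fst z), snd z)"

text \<open>The map on projective space induced by a map \<open>f\<close> that is constant on antipodes.\<close>

definition RP3_induced :: "(complex \<times> complex \<Rightarrow> 'b) \<Rightarrow> (complex \<times> complex) set \<Rightarrow> 'b" where
  "RP3_induced f P = the_elem (f ` P)"

definition h' :: "(complex \<times> complex) set \<Rightarrow> (complex \<times> complex) set" where
  "h' = RP3_induced hopf"

definition a'_map :: "int \<Rightarrow> (complex \<times> complex) set \<Rightarrow> (complex \<times> complex) set" where
  "a'_map k = RP3_induced (p3 \<circ> a_map k)"

lemma h'_p3: "h' (p3 z) = hopf z"
proof -
  have "S1_orbit (- z) = S1_orbit z"
    unfolding S1_orbit_def
    by (rule Collect_cong, rule iffI; clarsimp; rule_tac x = "- l" in exI; simp)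
  then show ?thesis by (simp add: h'_def RP3_induced_def p3_def hopf_def)
qed

lemma a'_map_p3:
  assumes "odd k"
  shows "a'_map k (p3 z) = p3 (a_map k z)"
proof -
  have "zpow k (- w) = - zpow k w" for w
    using assms by (auto simp: zpow_def even_nat_iff)
  then have "a_map k (- z) = - a_map k z"
    by (simp add: a_map_def norm_prod_def)
  then have "p3 (a_map k (- z)) = p3 (a_map k z)" by (auto simp: p3_def)
  then have "(p3 \<circ> a_map k) ` p3 z = {p3 (a_map k z)}" by (auto simp: p3_def[of z])
  then show ?thesis by (simp add: a'_map_def RP3_induced_def)
qed

text \<open>The class \<open>n[h]\<close>: maps homotopic to the composite of a self-map of \<open>S\<^sup>3\<close> of degree \<open>n\<close>
  with \<open>h\<close>. Since self-maps of \<open>S\<^sup>3\<close> are classified up to homotopy by their degree, this is a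
  single homotopy class.\<close>

definition nh_class :: "int \<Rightarrow> (complex \<times> complex \<Rightarrow> (complex \<times> complex) set) set" where
  "nh_class n =
     {f. \<exists>g. continuous_map S3 S3 g \<and> S3_degree g = n \<and> f \<in> homotopy_class S3 S2 (hopf \<circ> g)}"

text \<open>The argument \<open>q\<close> is a choice of the map \<open>q\<^sub>3\<close>; it only matters for even indices.\<close>

definition h'_class ::
  "((complex \<times> complex) set \<Rightarrow> complex \<times> complex) \<Rightarrow> int \<Rightarrow>
   ((complex \<times> complex) set \<Rightarrow> (complex \<times> complex) set) set" where
  "h'_class q m =
     (if odd m then homotopy_class RP3 S2 (h' \<circ> a'_map m)
      else if m = 0 then homotopy_class RP3 S2 (\<lambda>_. y0)
      else {\<phi>. \<exists>nh \<in> nh_class (m div 2). \<phi> \<in> homotopy_class RP3 S2 (nh \<circ> q)})"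

end

theory Submission
  imports Defs
begin

text \<open>
  For odd \<open>n\<close> the map \<open>h' \<circ> a'_map n\<close> itself has the fibre \<open>{[z, 0]}\<close> over \<open>y0\<close>, a circle with
  coordinate \<open>z\<^sup>2\<close>. For \<open>n = 2m\<close> a self-map \<open>G\<close> of \<open>S\<^sup>3\<close> of degree \<open>m\<close> may be chosen such that
  the fibre of \<open>hopf \<circ> G\<close> is a circle avoiding the point \<open>(a, b)\<close> to which \<open>q\<close> collapses
  \<open>\<real>P\<^sup>2\<close>; as \<open>q\<close> is injective elsewhere, the fibre of \<open>hopf \<circ> G \<circ> q\<close> is then a circle too. Take
  \<open>G = (w \<times> id) \<circ> R\<close> with \<open>R\<close> unitary and \<open>\<bar>w z\<bar> = \<bar>z\<bar>\<close>, so that \<open>w \<times> id\<close> preserves the circle \<open>z2 = 0\<close>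
  and its complement.

  To realise every degree by such a \<open>w\<close>, pinch: on \<open>Im z \<ge> 0\<close> apply a map of degree \<open>k\<close>, on
  \<open>Im z \<le> 0\<close> the identity, both after doubling the angle. A map that sends the equator into a
  closed hemisphere \<open>D\<close> has as degree the sum of the degrees of its two halves, because
  \<open>H(S) \<rightarrow> H(S, D)\<close> is injective and the class of \<open>S\<close> in \<open>H(S, E)\<close> is a sum of classes carried
  by the two hemispheres.
\<close>

section \<open>Homology: additivity of the degree over two hemispheres\<close>

text \<open>The isomorphism lets the image of \<open>c\<close> modulo \<open>B\<close> be lifted to
  a class \<open>u\<close> on \<open>A\<close>. Then \<open>c\<close> minus the image of
  \<open>u\<close> dies modulo \<open>B\<close>, so by exactness for the triple it comes from
  \<open>B\<close> relative to \<open>E\<close>. Below, \<open>A\<close> and \<open>B\<close> are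
  opposite hemispheres and \<open>E\<close> is their equator.\<close>

lemma relative_homology_group_sum_surj:
  assumes EB: "E \<subseteq> B"
    and iso: "hom_induced p (subtopology X A) E X B id
      \<in> iso (relative_homology_group p (subtopology X A) E) (relative_homology_group p X B)"
    and c: "c \<in> carrier (relative_homology_group p X E)"
  obtains u l where
    "u \<in> carrier (relative_homology_group p (subtopology X A) E)"
    "l \<in> carrier (relative_homology_group p (subtopology X B) E)"
    "c = hom_induced p (subtopology X A) E X E id u \<otimes>\<^bsub>relative_homology_group p X E\<^esub>
         hom_induced p (subtopology X B) E X E id l"
proof -
  let ?G = "relative_homology_group p X E"
  let ?i = "hom_induced p (subtopology X A) E X E id"
  let ?j = "hom_induced p X E X B id"
  interpret G: group ?G by simp
  interpret j: group_hom ?G "relative_homology_group p X B" ?j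
    by (simp add: group_hom_def group_hom_axioms_def hom_induced_hom)
  have "?j c \<in> carrier (relative_homology_group p X B)"
    by (rule hom_induced_carrier)
  then obtain u where u: "u \<in> carrier (relative_homology_group p (subtopology X A) E)"
      "hom_induced p (subtopology X A) E X B id u = ?j c"
    using iso unfolding iso_iff by (metis imageE)
  have iu: "?i u \<in> carrier ?G" by (rule hom_induced_carrier)
  have "?j (?i u) = hom_induced p (subtopology X A) E X B (id \<circ> id) u"
    using EB by (intro hom_induced_compose') (auto simp: continuous_map_from_subtopology)
  then have ju: "?j (?i u) = ?j c" using u(2) by simp
  define d where "d = inv\<^bsub>?G\<^esub> (?i u) \<otimes>\<^bsub>?G\<^esub> c"
  have dG: "d \<in> carrier ?G" using iu c by (simp add: d_def)
  have "?j d = \<one>\<^bsub>relative_homology_group p X B\<^esub>"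
    using iu c ju by (simp add: d_def)
  then have "d \<in> kernel ?G (relative_homology_group p X B) ?j"
    using dG by (simp add: kernel_def)
  also have "\<dots> = hom_induced p (subtopology X B) E X E id `
      carrier (relative_homology_group p (subtopology X B) E)"
    using homology_exactness_triple_3[OF EB, of p X] by simp
  finally obtain l where l: "l \<in> carrier (relative_homology_group p (subtopology X B) E)"
      "d = hom_induced p (subtopology X B) E X E id l" by blast
  have "c = ?i u \<otimes>\<^bsub>?G\<^esub> d"
    using iu c by (simp add: d_def flip: G.m_assoc)
  then show ?thesis using that u(1) l by blast
qed

text \<open>The induced map factors through the homology of \<open>D\<close> relative to itself,
  which is trivial.\<close>

lemma hom_induced_into_relative_subspace:
  assumes f: "continuous_map X Y f" "f \<in> topspace X \<rightarrow> D" and E: "E \<subseteq> topspace X"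
  shows "hom_induced p X E Y D f c = \<one>\<^bsub>relative_homology_group p Y D\<^esub>"
proof -
  \<comment> \<open>\<open>D\<close> may reach outside \<open>Y\<close>; the part inside is the
    whole space of \<open>subtopology Y D\<close>, for which the relative group is known to
    vanish.\<close>
  define D' where "D' = topspace (subtopology Y D)"
  let ?G = "relative_homology_group p (subtopology Y D) D'"
  have f': "continuous_map X (subtopology Y D) f"
    using f by (simp add: continuous_map_in_subtopology image_subset_iff_funcset)
  have "hom_induced p X E Y D (id \<circ> f) c
      = hom_induced p (subtopology Y D) D' Y D id (hom_induced p X E (subtopology Y D) D' f c)"
  proof (rule hom_induced_compose'[symmetric, OF f'])
    show "f \<in> E \<rightarrow> D'" using continuous_map_funspace[OF f'] E by (auto simp: D'_def)
  qed (auto simp: D'_def continuous_map_from_subtopology)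
  moreover have "hom_induced p X E (subtopology Y D) D' f c = \<one>\<^bsub>?G\<^esub>"
  proof -
    have "carrier ?G = {\<one>\<^bsub>?G\<^esub>}"
      using trivial_relative_homology_group_topspace[of p "subtopology Y D"]
      by (simp add: trivial_group_def D'_def)
    then show ?thesis
      using hom_induced_carrier[of p X E "subtopology Y D" D' f c] by simp
  qed
  moreover have "hom_induced p (subtopology Y D) D' Y D id \<one>\<^bsub>?G\<^esub> = \<one>\<^bsub>relative_homology_group p Y D\<^esub>"
    by (rule hom_one[OF hom_induced_hom]) (rule group_relative_homology_group)+
  ultimately show ?thesis by simp
qed

text \<open>Coordinate \<open>k\<close> cuts the source into halves, coordinate \<open>j\<close>
  selects the target hemisphere \<open>D\<close>. Modulo \<open>D\<close>, the map \<open>g\<close>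
  only sees the upper half and \<open>h\<close> only the lower one, and on these halves they
  coincide with \<open>f\<close>. The resulting sum formula in H(S, D) pulls back along the
  isomorphism \<open>?q\<close>.\<close>

proposition Brouwer_degree2_pinch:
  assumes f: "continuous_map (nsphere n) (nsphere n) f"
    and g: "continuous_map (nsphere n) (nsphere n) g"
    and h: "continuous_map (nsphere n) (nsphere n) h"
    and fg: "\<And>x. \<lbrakk>x \<in> topspace (nsphere n); x k \<ge> 0\<rbrakk> \<Longrightarrow> f x = g x"
    and fh: "\<And>x. \<lbrakk>x \<in> topspace (nsphere n); x k \<le> 0\<rbrakk> \<Longrightarrow> f x = h x"
    and gj: "\<And>x. \<lbrakk>x \<in> topspace (nsphere n); x k \<le> 0\<rbrakk> \<Longrightarrow> g x j \<ge> 0"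
    and hj: "\<And>x. \<lbrakk>x \<in> topspace (nsphere n); x k \<ge> 0\<rbrakk> \<Longrightarrow> h x j \<ge> 0"
    and j: "j \<le> n"
  shows "Brouwer_degree2 n f = Brouwer_degree2 n g + Brouwer_degree2 n h"
proof (rule Brouwer_degree2_unique[OF f])
  define S where "S = nsphere n"
  define U where "U = {x :: nat \<Rightarrow> real. x k \<ge> 0}"
  define L where "L = {x :: nat \<Rightarrow> real. x k \<le> 0}"
  define E where "E = topspace S \<inter> {x. x k = 0}"
  define D where "D = {x :: nat \<Rightarrow> real. x j \<ge> 0}"
  let ?p = "int n"
  let ?R = "reduced_homology_group ?p S"
  let ?Q = "relative_homology_group ?p S D"
  let ?iU = "hom_induced ?p (subtopology S U) E S E id"
  let ?iL = "hom_induced ?p (subtopology S L) E S E id"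
  let ?HE = "relative_homology_group ?p S E"
  let ?q = "hom_induced ?p S {} S D id"
  have EU: "E \<subseteq> U" and EL: "E \<subseteq> L" and ES: "E \<subseteq> topspace S"
    by (auto simp: E_def U_def L_def)
  interpret R: group ?R by simp
  interpret Q: group ?Q by simp
  have q: "?q \<in> iso ?R ?Q"
    unfolding S_def D_def by (rule iso_reduced_homology_group_upper_hemisphere[OF j])
  fix a assume a: "a \<in> carrier (reduced_homology_group (int n) (nsphere n))"
  then have a: "a \<in> carrier ?R" by (simp add: S_def)
  define c where "c = hom_induced ?p S {} S E id a"
  \<comment> \<open>An isomorphism of excision type. The rule applied has the uncut hyperplane
    \<open>{x. x k = 0}\<close> instead of \<open>E\<close>; relative groups depend only on the part
    inside the space.\<close>
  have "hom_induced ?p (subtopology S U) E S L id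
      \<in> iso (relative_homology_group ?p (subtopology S U) E) (relative_homology_group ?p S L)"
  proof -
    have E: "topspace (subtopology S U) \<inter> {x. x k = 0} = topspace (subtopology S U) \<inter> E"
      by (auto simp: E_def)
    show ?thesis
      using iso_relative_homology_group_upper_hemisphere[of ?p n k]
      unfolding S_def[symmetric] U_def[symmetric] L_def[symmetric]
      by (metis E hom_induced_restrict relative_homology_group_restrict)
  qed
  moreover have "c \<in> carrier ?HE" unfolding c_def by (rule hom_induced_carrier)
  ultimately obtain u l where c: "c = ?iU u \<otimes>\<^bsub>?HE\<^esub> ?iL l"
    using relative_homology_group_sum_surj[OF EL] by metis
  have iU: "?iU u \<in> carrier ?HE" and iL: "?iL l \<in> carrier ?HE"
    by (rule hom_induced_carrier)+
  let ?ind = "\<lambda>r. hom_induced ?p S {} S {} r a"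
  \<comment> \<open>The splitting of \<open>c\<close> into \<open>u\<close> and \<open>l\<close> is
    fixed before the map is chosen, so one formula serves \<open>f\<close>, \<open>g\<close> and
    \<open>h\<close>.\<close>
  have *: "?q (?ind r) = hom_induced ?p (subtopology S U) E S D r u \<otimes>\<^bsub>?Q\<^esub>
        hom_induced ?p (subtopology S L) E S D r l"
    if r: "continuous_map S S r" and rE: "r \<in> E \<rightarrow> D" for r
  proof -
    have sub: "hom_induced ?p S E S D r (hom_induced ?p (subtopology S V) E S E id v)
        = hom_induced ?p (subtopology S V) E S D (r \<circ> id) v" for V v
      using r rE by (intro hom_induced_compose') (auto simp: continuous_map_from_subtopology)
    have "?q (?ind r) = hom_induced ?p S {} S D (id \<circ> r) a"
      using r by (intro hom_induced_compose') auto
    also have "\<dots> = hom_induced ?p S {} S D (r \<circ> id) a" by simp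
    also have "\<dots> = hom_induced ?p S E S D r c"
      unfolding c_def using r rE by (intro hom_induced_compose'[symmetric]) auto
    also have "\<dots> = hom_induced ?p S E S D r (?iU u) \<otimes>\<^bsub>?Q\<^esub> hom_induced ?p S E S D r (?iL l)"
      unfolding c by (rule hom_mult[OF hom_induced_hom iU iL])
    finally show ?thesis by (simp add: sub)
  qed
  have fU: "hom_induced ?p (subtopology S U) E S D f = hom_induced ?p (subtopology S U) E S D g"
    by (rule hom_induced_eq) (simp add: fg S_def U_def)
  have fL: "hom_induced ?p (subtopology S L) E S D f = hom_induced ?p (subtopology S L) E S D h"
    by (rule hom_induced_eq) (simp add: fh S_def L_def)
  have gL: "hom_induced ?p (subtopology S L) E S D g l = \<one>\<^bsub>?Q\<^esub>"
  proof (rule hom_induced_into_relative_subspace)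
    show "g \<in> topspace (subtopology S L) \<rightarrow> D" using gj by (auto simp: S_def L_def D_def)
  qed (use g EL ES in \<open>auto simp: S_def continuous_map_from_subtopology\<close>)
  have hU: "hom_induced ?p (subtopology S U) E S D h u = \<one>\<^bsub>?Q\<^esub>"
  proof (rule hom_induced_into_relative_subspace)
    show "h \<in> topspace (subtopology S U) \<rightarrow> D" using hj by (auto simp: S_def U_def D_def)
  qed (use h EU ES in \<open>auto simp: S_def continuous_map_from_subtopology\<close>)
  have gE: "g \<in> E \<rightarrow> D" and hE: "h \<in> E \<rightarrow> D"
    using gj hj by (auto simp: S_def E_def D_def)
  then have fE: "f \<in> E \<rightarrow> D" using fg by (auto simp: S_def E_def D_def)
  note cont = f[folded S_def] g[folded S_def] h[folded S_def]
  have R: "?ind r \<in> carrier ?R" for r using a by (rule hom_induced_reduced)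
  have Q: "hom_induced ?p Z E S D r z \<in> carrier ?Q" for Z r and z :: "(nat \<Rightarrow> real) chain set"
    by (rule hom_induced_carrier)
  have "?q (?ind f) = ?q (?ind g) \<otimes>\<^bsub>?Q\<^esub> ?q (?ind h)"
    unfolding *[OF cont(1) fE] *[OF cont(2) gE] *[OF cont(3) hE] fU fL gL hU
    using Q[of "subtopology S U" g u] Q[of "subtopology S L" h l]
    by (simp del: one_relative_homology_group)
  also have "\<dots> = ?q (?ind g \<otimes>\<^bsub>?R\<^esub> ?ind h)"
    using q hom_mult[of ?q ?R ?Q, OF _ R[of g] R[of h]] by (simp add: iso_iff)
  finally have "?ind f = ?ind g \<otimes>\<^bsub>?R\<^esub> ?ind h"
    using q R[of f] R.m_closed[OF R[of g] R[of h]] unfolding iso_iff by (meson inj_onD)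
  then show "hom_induced (int n) (nsphere n) {} (nsphere n) {} f a
      = a [^]\<^bsub>reduced_homology_group (int n) (nsphere n)\<^esub> (Brouwer_degree2 n g + Brouwer_degree2 n h)"
    using a Brouwer_degree2[of a n g] Brouwer_degree2[of a n h] unfolding S_def
    by (simp add: group.int_pow_mult)
qed

section \<open>The degree of self-maps of \<open>S3\<close>\<close>

lemma S3_eq_sphere: "S3 = top_of_set (sphere 0 1)"
proof -
  have "{(z1, z2). (cmod z1)\<^sup>2 + (cmod z2)\<^sup>2 = 1} = sphere (0 :: complex \<times> complex) 1"
    by (auto simp: norm_prod_def sphere_def dist_norm)
  then show ?thesis by (simp add: S3_def)
qed

lemma continuous_map_S3_nsphere:
  "continuous_map S3 (nsphere 3) S3_to_nsphere" "continuous_map (nsphere 3) S3 nsphere_to_S3"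
  using homeomorphic_maps_S3_nsphere by (simp_all add: homeomorphic_maps_def)

lemma continuous_map_nsphere_conjugate:
  assumes "continuous_map S3 S3 f"
  shows "continuous_map (nsphere 3) (nsphere 3) (S3_to_nsphere \<circ> f \<circ> nsphere_to_S3)"
  using assms continuous_map_S3_nsphere by (intro continuous_map_compose)

lemma nsphere_to_S3_inverse: "nsphere_to_S3 (S3_to_nsphere z) = z"
  by (simp add: nsphere_to_S3_def S3_to_nsphere_def)

lemma S3_degree_compose:
  assumes "continuous_map S3 S3 f" "continuous_map S3 S3 g"
  shows "S3_degree (g \<circ> f) = S3_degree g * S3_degree f"
proof -
  have "S3_to_nsphere \<circ> (g \<circ> f) \<circ> nsphere_to_S3
      = (S3_to_nsphere \<circ> g \<circ> nsphere_to_S3) \<circ> (S3_to_nsphere \<circ> f \<circ> nsphere_to_S3)"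
    by (simp add: fun_eq_iff nsphere_to_S3_inverse)
  then show ?thesis
    unfolding S3_degree_def
    using Brouwer_degree2_compose assms[THEN continuous_map_nsphere_conjugate] by metis
qed

lemma S3_degree_homotopic:
  assumes "homotopic_with (\<lambda>_. True) S3 S3 f g"
  shows "S3_degree f = S3_degree g"
  unfolding S3_degree_def
  by (intro Brouwer_degree2_homotopic
    homotopic_with_compose_continuous_map_right[OF _ continuous_map_S3_nsphere(2)]
    homotopic_with_compose_continuous_map_left[OF assms continuous_map_S3_nsphere(1)]) auto

lemma S3_degree_id: "S3_degree id = 1"
proof -
  have "S3_degree id = Brouwer_degree2 3 id"
    unfolding S3_degree_def
    using homeomorphic_maps_S3_nsphere
    by (intro Brouwer_degree2_eq) (auto simp: homeomorphic_maps_def)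
  then show ?thesis by simp
qed

text \<open>Only the real part of the first component changes sign, which is coordinate 0 of
  \<open>nsphere 3\<close>. This reflection later supplies the negative degrees.\<close>

lemma S3_degree_reflection: "S3_degree (map_prod (\<lambda>z. - cnj z) id) = -1"
proof -
  have "S3_degree (map_prod (\<lambda>z. - cnj z) id) = Brouwer_degree2 3 (\<lambda>x i. if i = 0 then - x i else x i)"
    unfolding S3_degree_def
    by (rule Brouwer_degree2_eq) (auto simp: fun_eq_iff S3_to_nsphere_def nsphere_to_S3_def nsphere)
  then show ?thesis by (simp add: Brouwer_degree2_reflection)
qed

text \<open>By multiplicativity the degree is a unit of the integers. The sign stays open; the later
  use needs only that its square is 1.\<close>

lemma S3_degree_homeomorphic_maps:
  assumes "homeomorphic_maps S3 S3 f g"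
  shows "\<bar>S3_degree f\<bar> = 1"
proof -
  have cont: "continuous_map S3 S3 f" "continuous_map S3 S3 g"
    using assms by (auto simp: homeomorphic_maps_def)
  have "homotopic_with (\<lambda>_. True) S3 S3 (g \<circ> f) id"
    using assms cont
    by (intro homotopic_with_equal) (auto simp: homeomorphic_maps_def continuous_map_compose)
  then have "S3_degree g * S3_degree f = 1"
    using S3_degree_homotopic S3_degree_compose[OF cont] S3_degree_id by metis
  then show ?thesis by (auto simp: zmult_eq_1_iff)
qed

text \<open>The equator is cut out by Im z1 (coordinate 1) and the target hemisphere is Re z1 >= 0
  (coordinate 0). This suits angle doubling, which sends the real line to the nonnegative
  reals.\<close>

lemma S3_degree_pinch:
  assumes cont: "continuous_map S3 S3 f" "continuous_map S3 S3 g" "continuous_map S3 S3 h"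
    and fg: "\<And>z. \<lbrakk>z \<in> topspace S3; Im (fst z) \<ge> 0\<rbrakk> \<Longrightarrow> f z = g z"
    and fh: "\<And>z. \<lbrakk>z \<in> topspace S3; Im (fst z) \<le> 0\<rbrakk> \<Longrightarrow> f z = h z"
    and g: "\<And>z. \<lbrakk>z \<in> topspace S3; Im (fst z) \<le> 0\<rbrakk> \<Longrightarrow> Re (fst (g z)) \<ge> 0"
    and h: "\<And>z. \<lbrakk>z \<in> topspace S3; Im (fst z) \<ge> 0\<rbrakk> \<Longrightarrow> Re (fst (h z)) \<ge> 0"
  shows "S3_degree f = S3_degree g + S3_degree h"
proof -
  have N: "nsphere_to_S3 x \<in> topspace S3" if "x \<in> topspace (nsphere 3)" for x
    using that homeomorphic_maps_S3_nsphere
    by (auto simp: homeomorphic_maps_def dest: continuous_map_funspace)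
  have 0: "S3_to_nsphere z 0 = Re (fst z)" and 1: "Im (fst (nsphere_to_S3 x)) = x 1" for z x
    by (simp_all add: S3_to_nsphere_def nsphere_to_S3_def)
  show ?thesis
    unfolding S3_degree_def
    by (rule Brouwer_degree2_pinch[where k = 1 and j = 0])
      (use cont[THEN continuous_map_nsphere_conjugate] N in \<open>simp_all add: fg fh g h 0 1\<close>)
qed

section \<open>Self-maps \<open>map_prod w id\<close> of every nonzero degree\<close>

text \<open>Preserving the norm keeps \<open>map_prod w id\<close> on the sphere without any
  normalisation.\<close>

definition norm_preserving :: "(complex \<Rightarrow> complex) \<Rightarrow> bool" where
  "norm_preserving w \<longleftrightarrow> continuous_on UNIV w \<and> (\<forall>z. cmod (w z) = cmod z)"

lemma norm_preserving_compose:
  assumes "norm_preserving v" "norm_preserving w"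
  shows "norm_preserving (v \<circ> w)"
  using assms continuous_on_compose2[of UNIV v UNIV w]
  by (simp add: norm_preserving_def o_def)

lemma continuous_map_S3_map_prod:
  assumes "norm_preserving w"
  shows "continuous_map S3 S3 (map_prod w id)"
proof -
  have "continuous_on UNIV w" using assms by (simp add: norm_preserving_def)
  then have "continuous_on (sphere 0 1) (\<lambda>z :: complex \<times> complex. w (fst z))"
    by (rule continuous_on_compose2[of UNIV w]) (auto intro: continuous_intros)
  then have "continuous_on (sphere 0 1) (\<lambda>z :: complex \<times> complex. (w (fst z), snd z))"
    by (intro continuous_on_Pair continuous_on_snd continuous_on_id)
  then show ?thesis
    using assms
    by (auto simp: S3_eq_sphere norm_preserving_def norm_Pair map_prod_def case_prod_beta)
qed

text \<open>The straight-line homotopy, normalised, joins the two maps if no segment meets 0. The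
  second component \<open>b\<close> is constant along a segment, so only \<open>b = 0\<close>
  matters; there both ends have the same norm, so 0 could only be the midpoint, making the ends
  antipodal.\<close>

lemma S3_degree_map_prod_cong:
  assumes w: "norm_preserving w" and v: "norm_preserving v"
    and wv: "\<And>z. z \<noteq> 0 \<Longrightarrow> w z \<noteq> - v z"
  shows "S3_degree (map_prod w id) = S3_degree (map_prod v id)"
proof (rule S3_degree_homotopic)
  let ?n = "\<lambda>z :: complex \<times> complex. inverse (norm z) *\<^sub>R z"
  let ?S = "sphere (0 :: complex \<times> complex) 1"
  have cont: "continuous_on ?S (map_prod u id)" if "norm_preserving u" for u
    using continuous_map_S3_map_prod[OF that] by (simp add: S3_eq_sphere)
  have n: "norm (map_prod u id z) = norm z" if "norm_preserving u" for u z
    using that by (cases z) (simp add: norm_preserving_def norm_Pair)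
  have "homotopic_with_canon (\<lambda>_. True) ?S (- {0}) (map_prod w id) (map_prod v id)"
  proof (rule homotopic_with_linear)
    fix z assume zS: "z \<in> ?S"
    obtain a b where ab: "z = (a, b)" by (cases z)
    have z: "z = (a, b)" "a \<noteq> 0 \<or> b \<noteq> 0" using zS by (auto simp: ab norm_Pair)
    have "0 \<notin> closed_segment (map_prod w id z) (map_prod v id z)"
    proof
      assume "0 \<in> closed_segment (map_prod w id z) (map_prod v id z)"
      then obtain t where t: "0 \<le> t" "t \<le> 1" "0 = (1 - t) *\<^sub>R w a + t *\<^sub>R v a" "0 = (1 - t) *\<^sub>R b + t *\<^sub>R b"
        by (auto simp: in_segment z zero_prod_def)
      have "b = 0" using t(4) by (simp flip: scaleR_add_left)
      then have a: "a \<noteq> 0" using z by simp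
      have e: "(1 - t) *\<^sub>R w a = - (t *\<^sub>R v a)" using t(3) by (simp add: eq_neg_iff_add_eq_0)
      from arg_cong[OF this, of norm] have "(1 - t) * cmod a = t * cmod a"
        using t w v by (simp add: norm_preserving_def)
      then have "t = 1/2" using a by simp
      with e have "w a = - v a" by (simp add: scaleR_conv_of_real)
      then show False using wv a by blast
    qed
    then show "closed_segment (map_prod w id z) (map_prod v id z) \<subseteq> - {0}" by blast
  qed (use cont w v in auto)
  moreover have "continuous_map (top_of_set (- {0})) (top_of_set ?S) ?n"
    by (auto intro!: continuous_intros)
  ultimately have "homotopic_with_canon (\<lambda>_. True) ?S ?S (?n \<circ> map_prod w id) (?n \<circ> map_prod v id)"
    by (rule homotopic_with_compose_continuous_map_left) simp
  then have "homotopic_with (\<lambda>_. True) S3 S3 (?n \<circ> map_prod w id) (?n \<circ> map_prod v id)"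
    by (simp add: S3_eq_sphere)
  \<comment> \<open>Both maps already take values of norm 1, so normalising does not change them on
    the sphere.\<close>
  moreover have "homotopic_with (\<lambda>_. True) S3 S3 (map_prod u id) (?n \<circ> map_prod u id)"
    if "norm_preserving u" for u
    by (intro homotopic_with_equal continuous_map_S3_map_prod that) (simp_all add: S3_eq_sphere n that)
  note normalize = this
  ultimately have "homotopic_with (\<lambda>_. True) S3 S3 (?n \<circ> map_prod w id) (map_prod v id)"
    using homotopic_with_trans homotopic_with_symD[OF normalize[OF v]] by blast
  with normalize[OF w] show "homotopic_with (\<lambda>_. True) S3 S3 (map_prod w id) (map_prod v id)"
    by (rule homotopic_with_trans)
qed

text \<open>Isabelle's \<open>x / 0 = 0\<close> gives the continuous value \<open>double_angle 0 = 0\<close>.\<close>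

definition double_angle :: "complex \<Rightarrow> complex" where
  "double_angle z = z\<^sup>2 / cmod z"

text \<open>Doubling the angle wraps each closed half-plane once around the plane and folds its
  boundary, the real line, onto the nonnegative reals. This is the pinch of a circle to a wedge of
  two circles, carried out at every radius.\<close>

definition pinch :: "(complex \<Rightarrow> complex) \<Rightarrow> (complex \<Rightarrow> complex) \<Rightarrow> complex \<Rightarrow> complex" where
  "pinch v w z = (if Im z \<ge> 0 then v (double_angle z) else w (double_angle z))"

lemma norm_double_angle: "cmod (double_angle z) = cmod z"
  by (cases "z = 0") (simp_all add: double_angle_def norm_divide norm_mult power2_eq_square)

lemma double_angle_real: "Im z = 0 \<Longrightarrow> double_angle z = cmod z"
  by (cases z) (auto simp: double_angle_def power2_eq_square complex_eq_iff cmod_def abs_if)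

lemma norm_preserving_double_angle: "norm_preserving double_angle"
proof -
  have "isCont double_angle z" for z
  proof (cases "z = 0")
    case True
    have "(\<lambda>h. cmod h) \<midarrow>0\<rightarrow> 0" by (rule tendsto_norm_zero) (rule tendsto_ident_at)
    then have "(\<lambda>h. cmod (double_angle h)) \<midarrow>0\<rightarrow> 0" by (simp add: norm_double_angle)
    then have "double_angle \<midarrow>0\<rightarrow> 0" by (rule tendsto_norm_zero_cancel)
    then show ?thesis using True by (simp add: isCont_def double_angle_def)
  next
    case False
    then show ?thesis unfolding double_angle_def by (intro continuous_intros) auto
  qed
  then show ?thesis by (simp add: norm_preserving_def norm_double_angle continuous_at_imp_continuous_on)
qed

text \<open>The two branches meet on the real line, where \<open>double_angle\<close> takes
  nonnegative real values. Both \<open>v\<close> and \<open>w\<close> fix these, so the branches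
  agree and glue.\<close>

lemma norm_preserving_pinch:
  assumes v: "norm_preserving v" and w: "norm_preserving w"
    and pos: "\<And>r. r \<ge> 0 \<Longrightarrow> v (of_real r) = of_real r" "\<And>r. r \<ge> 0 \<Longrightarrow> w (of_real r) = of_real r"
  shows "norm_preserving (pinch v w)"
proof -
  have cont: "continuous_on S (\<lambda>z. u (double_angle z))" if "norm_preserving u" for u S
    using norm_preserving_compose[OF that norm_preserving_double_angle]
    by (auto simp: norm_preserving_def o_def intro: continuous_on_subset)
  have "continuous_on ({z. Im z \<ge> 0} \<union> {z. Im z \<le> 0}) (\<lambda>z. if Im z \<ge> 0 then v (double_angle z) else w (double_angle z))"
  proof (rule continuous_on_cases[OF _ _ cont[OF v] cont[OF w]])
    show "closed {z. Im z \<ge> 0}" "closed {z. Im z \<le> 0}"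
      by (intro closed_Collect_le continuous_on_Im continuous_on_const continuous_on_id)+
  qed (auto simp: double_angle_real pos)
  moreover have "{z. Im z \<ge> 0} \<union> {z. Im z \<le> 0} = UNIV" by auto
  ultimately show ?thesis
    using v w by (simp add: norm_preserving_def pinch_def[abs_def] norm_double_angle)
qed

text \<open>Each half pinch is nowhere antipodal to a quarter turn, which is nowhere antipodal to the
  identity.\<close>

lemma S3_degree_half_pinch:
  shows "S3_degree (map_prod (pinch id (\<lambda>z. cmod z)) id) = 1"
    and "S3_degree (map_prod (pinch (\<lambda>z. cmod z) id) id) = 1"
proof -
  have c: "norm_preserving (\<lambda>z. complex_of_real (cmod z))"
    by (auto simp: norm_preserving_def intro!: continuous_intros)
  have rot: "norm_preserving ((*) \<i>)" "norm_preserving ((*) (- \<i>))" "norm_preserving id"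
    by (auto simp: norm_preserving_def norm_mult intro!: continuous_intros)
  have np: "norm_preserving (pinch id (\<lambda>z. cmod z))" "norm_preserving (pinch (\<lambda>z. cmod z) id)"
    by (auto intro!: norm_preserving_pinch c rot)
  have double_angle: "double_angle z = z * (z / cmod z)" for z by (simp add: double_angle_def power2_eq_square)
  \<comment> \<open>With t the angle of \<open>z\<close>, antipodality to the quarter turn means 2t
    = t + 3 pi/2 on the upper half and 0 = t + 3 pi/2 on the lower one. The solutions t = 3 pi/2 and
    t = pi/2 each lie in the wrong half. Fact \<open>2\<close> is the mirror image.\<close>
  have 1: "pinch id (\<lambda>z. cmod z) z \<noteq> - (\<i> * z)" if "z \<noteq> 0" for z
  proof
    assume *: "pinch id (\<lambda>z. cmod z) z = - (\<i> * z)"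
    show False
    proof (cases "Im z \<ge> 0")
      case True
      then have "z * (z / cmod z) = z * (- \<i>)" using * by (simp add: pinch_def double_angle)
      then have "z / cmod z = - \<i>" using that by (metis mult_left_cancel)
      then have "z = - \<i> * cmod z" using that by (simp add: field_simps)
      then have "Im z = - cmod z" by (metis Im_i_times mult_minus_left uminus_complex.simps(2) Re_complex_of_real)
      then show False using True that by simp
    next
      case False
      then have "complex_of_real (cmod z) = - (\<i> * z)" using * by (simp add: pinch_def norm_double_angle)
      then have "cmod z = Im z" by (simp add: complex_eq_iff)
      then show False using False by (smt (verit) norm_ge_zero)
    qed
  qed
  have 2: "pinch (\<lambda>z. cmod z) id z \<noteq> - (- \<i> * z)" if "z \<noteq> 0" for z
  proof
    assume *: "pinch (\<lambda>z. cmod z) id z = - (- \<i> * z)"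
    show False
    proof (cases "Im z \<ge> 0")
      case False
      then have "z * (z / cmod z) = z * \<i>" using * by (simp add: pinch_def double_angle)
      then have "z / cmod z = \<i>" using that by (metis mult_left_cancel)
      then have "z = \<i> * cmod z" using that by (simp add: field_simps)
      then have "Im z = cmod z" by (metis Im_i_times Re_complex_of_real)
      then show False using False by (smt (verit) norm_ge_zero)
    next
      case True
      then have "complex_of_real (cmod z) = \<i> * z" using * by (simp add: pinch_def norm_double_angle)
      then have "cmod z = - Im z" by (simp add: complex_eq_iff)
      moreover have "cmod z > 0" using that by simp
      ultimately show False using True by linarith
    qed
  qed
  have 3: "l * z \<noteq> - id z" if "z \<noteq> 0" "l \<noteq> -1" for l z :: complex
    using that by (metis id_apply mult_cancel_right mult_minus1)
  have [simp]: "\<i> \<noteq> -1" "- \<i> \<noteq> -1" by (auto simp: complex_eq_iff)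
  have "S3_degree (map_prod ((*) \<i>) id) = S3_degree (map_prod id id)"
    "S3_degree (map_prod ((*) (- \<i>)) id) = S3_degree (map_prod id id)"
    by (intro S3_degree_map_prod_cong rot 3; simp)+
  moreover have "S3_degree (map_prod (pinch id (\<lambda>z. cmod z)) id) = S3_degree (map_prod ((*) \<i>) id)"
    using 1 by (intro S3_degree_map_prod_cong np rot)
  moreover have "S3_degree (map_prod (pinch (\<lambda>z. cmod z) id) id) = S3_degree (map_prod ((*) (- \<i>)) id)"
    using 2 by (intro S3_degree_map_prod_cong np rot)
  ultimately show "S3_degree (map_prod (pinch id (\<lambda>z. cmod z)) id) = 1"
    "S3_degree (map_prod (pinch (\<lambda>z. cmod z) id) id) = 1"
    by (simp_all add: map_prod.id S3_degree_id)
qed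

text \<open>\<open>J\<close> and \<open>J'\<close> each send one half-plane to the nonnegative
  reals, which \<open>v\<close> fixes. So \<open>v \<circ> J\<close> and \<open>J'\<close> are the
  two summands for \<open>S3_degree_pinch\<close>, and \<open>J\<close> and \<open>J'\<close> have
  degree 1 as half pinches.\<close>

lemma S3_degree_pinch_id:
  assumes v: "norm_preserving v" and pos: "\<And>r. r \<ge> 0 \<Longrightarrow> v (of_real r) = of_real r"
  shows "S3_degree (map_prod (pinch v id) id) = S3_degree (map_prod v id) + 1"
proof -
  define J where "J = pinch id (\<lambda>z. complex_of_real (cmod z))"
  define J' where "J' = pinch (\<lambda>z. complex_of_real (cmod z)) id"
  have c: "norm_preserving (\<lambda>z. complex_of_real (cmod z))" "norm_preserving id"
    by (auto simp: norm_preserving_def intro!: continuous_intros)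
  have np: "norm_preserving J" "norm_preserving J'" "norm_preserving (pinch v id)"
    unfolding J_def J'_def by (auto intro!: norm_preserving_pinch c v pos)
  have "S3_degree (map_prod (pinch v id) id)
      = S3_degree (map_prod (v \<circ> J) id) + S3_degree (map_prod J' id)"
  proof (rule S3_degree_pinch)
    fix z :: "complex \<times> complex"
    show "map_prod (pinch v id) id z = map_prod (v \<circ> J) id z" if "Im (fst z) \<ge> 0"
      using that by (cases z) (simp add: pinch_def J_def)
    \<comment> \<open>On the equator the definition of \<open>pinch\<close> selects the branch
      \<open>v\<close>; it agrees with \<open>J'\<close> there because \<open>v\<close> fixes the
      nonnegative reals.\<close>
    show "map_prod (pinch v id) id z = map_prod J' id z" if "Im (fst z) \<le> 0"
      using that by (cases z) (auto simp: pinch_def J'_def double_angle_real pos norm_double_angle)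
    show "Re (fst (map_prod (v \<circ> J) id z)) \<ge> 0" if "Im (fst z) \<le> 0"
      using that by (cases z) (auto simp: pinch_def J_def double_angle_real pos norm_double_angle)
    show "Re (fst (map_prod J' id z)) \<ge> 0" if "Im (fst z) \<ge> 0"
      using that by (cases z) (auto simp: pinch_def J'_def norm_double_angle)
  qed (auto intro: continuous_map_S3_map_prod norm_preserving_compose np v)
  also have "map_prod (v \<circ> J) id = map_prod v id \<circ> map_prod J (id :: complex \<Rightarrow> complex)"
    by (simp add: map_prod.comp)
  also have "S3_degree \<dots> = S3_degree (map_prod v id) * S3_degree (map_prod J id)"
    by (intro S3_degree_compose continuous_map_S3_map_prod np v)
  finally show ?thesis
    unfolding J_def J'_def S3_degree_half_pinch by (simp only: mult_1_right)
qed

text \<open>Start from the identity, of degree 1, and pinch with the identity repeatedly, each time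
  adding 1. The induction carries along that \<open>w\<close> fixes the nonnegative reals, as the
  next pinch requires it. The reflection destroys this property and is therefore composed only at
  the end.\<close>

lemma ex_norm_preserving_degree:
  assumes "m \<noteq> 0"
  obtains w where "norm_preserving w" "S3_degree (map_prod w id) = m"
proof -
  have pos: "\<exists>w. norm_preserving w \<and> (\<forall>r\<ge>0. w (of_real r) = of_real r) \<and>
      S3_degree (map_prod w id) = int (Suc k)" for k
  proof (induction k)
    case 0
    have "norm_preserving id" by (auto simp: norm_preserving_def)
    moreover have "S3_degree (map_prod id id) = 1" unfolding map_prod.id by (rule S3_degree_id)
    ultimately show ?case
      by (intro exI[of _ id] conjI allI impI id_apply) (simp_all only: of_nat_Suc of_nat_0 add_0_right)
  next
    case (Suc k)
    then obtain w where w: "norm_preserving w" "\<forall>r\<ge>0. w (of_real r) = of_real r"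
      "S3_degree (map_prod w id) = int (Suc k)" by blast
    show ?case
    proof (intro exI conjI allI impI)
      show "norm_preserving (pinch w id)"
        using w by (intro norm_preserving_pinch) (auto simp: norm_preserving_def)
      show "pinch w id (of_real r) = of_real r" if "r \<ge> 0" for r
        using w(2) that by (simp add: pinch_def double_angle_real)
      show "S3_degree (map_prod (pinch w id) id) = int (Suc (Suc k))"
        using w S3_degree_pinch_id[of w] by simp
    qed
  qed
  obtain k where k: "\<bar>m\<bar> = int (Suc k)"
    using assms by (intro that[of "nat \<bar>m\<bar> - 1"]) auto
  obtain w where w: "norm_preserving w" "S3_degree (map_prod w id) = \<bar>m\<bar>"
    using pos[of k] k by auto
  show ?thesis
  proof (cases "m > 0")
    case True
    then show ?thesis using w that by simp
  next
    case False
    define r where "r = (\<lambda>z. - cnj z)"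
    have r: "norm_preserving r"
      by (auto simp: norm_preserving_def r_def intro!: continuous_intros)
    have "S3_degree (map_prod (r \<circ> w) id) = S3_degree (map_prod r id \<circ> map_prod w id)"
      by (simp add: map_prod.comp)
    also have "\<dots> = S3_degree (map_prod r id) * S3_degree (map_prod w id)"
      by (intro S3_degree_compose continuous_map_S3_map_prod r w)
    also have "\<dots> = m"
      using False w by (simp add: r_def S3_degree_reflection)
    finally show ?thesis using that norm_preserving_compose[OF r w(1)] by blast
  qed
qed

section \<open>Fibres over \<open>y0\<close>: general facts and odd indices\<close>

text \<open>The invariants of \<open>S1_orbit_eq_iff\<close> take the value (0, 1) at (1, 0). On the
  sphere the second invariant equals 1 only where the second component vanishes.\<close>

lemma hopf_eq_y0_iff:
  assumes "z \<in> topspace S3"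
  shows "hopf z = y0 \<longleftrightarrow> snd z = 0"
proof -
  obtain a b where z: "z = (a, b)" by (cases z)
  have ab: "(cmod a)\<^sup>2 + (cmod b)\<^sup>2 = 1" using assms by (simp add: z topspace_S3)
  have "hopf z = y0 \<longleftrightarrow> a * cnj b = 0 \<and> (cmod a)\<^sup>2 - (cmod b)\<^sup>2 = 1"
    unfolding hopf_def y0_def
    by (subst S1_orbit_eq_iff[OF assms]) (auto simp: z topspace_S3)
  also have "\<dots> \<longleftrightarrow> b = 0" using ab by auto
  finally show ?thesis by (simp add: z)
qed

lemma continuous_map_hopf: "continuous_map S3 S2 hopf"
  using quotient_imp_continuous_map[OF quotient_map_quotient_topology]
  by (simp add: S2_def hopf_def[abs_def])

lemma compact_space_S3: "compact_space S3"
  by (simp add: S3_eq_sphere compact_space_subtopology)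

lemma quotient_map_p3: "quotient_map S3 RP3 p3"
  unfolding RP3_def by (rule quotient_map_quotient_topology)

lemma topspace_RP3: "topspace RP3 = p3 ` topspace S3"
  by (simp add: RP3_def)

lemma compact_space_RP3: "compact_space RP3"
  unfolding compact_space_def topspace_RP3
  by (intro image_compactin[of S3] quotient_imp_continuous_map[OF quotient_map_p3])
    (simp add: compact_space_S3 flip: compact_space_def)

text \<open>A continuous bijection from a compact space to a Hausdorff space is a homeomorphism.
  Describing the fibre as the zero set of \<open>g\<close> makes it closed, hence compact, without
  any separation property of \<open>S2\<close>. Both parities end with this lemma.\<close>

lemma zero_set_homeomorphic_circle:
  fixes f g :: "'a \<Rightarrow> complex"
  assumes X: "compact_space X" and f: "continuous_map X euclidean f" and g: "continuous_map X euclidean g"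
    and A: "A = {x \<in> topspace X. g x = 0}"
    and inj: "inj_on f A" and im: "f ` A = sphere 0 1"
  shows "subtopology X A homeomorphic_space top_of_set (sphere (0 :: complex) 1)"
proof -
  have A': "topspace (subtopology X A) = A" by (auto simp: A)
  have "homeomorphic_map (subtopology X A) (top_of_set (sphere 0 1)) f"
  proof (rule continuous_imp_homeomorphic_map)
    show "continuous_map (subtopology X A) (top_of_set (sphere 0 1)) f"
      using f im A' by (auto simp: continuous_map_in_subtopology continuous_map_from_subtopology)
    have "closedin X {x \<in> topspace X. g x \<in> {0}}"
      by (rule closedin_continuous_map_preimage[OF g]) simp
    then have "closedin X A" by (simp add: A)
    then show "compact_space (subtopology X A)"
      using X by (simp add: closedin_compact_space compact_space_subtopology)
  qed (use inj im A' in \<open>auto simp: Hausdorff_space_subtopology\<close>)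
  then show ?thesis by (rule homeomorphic_map_imp_homeomorphic_space)
qed

lemma RP3_induced_p3:
  assumes "\<phi> (- z) = \<phi> z"
  shows "RP3_induced \<phi> (p3 z) = \<phi> z"
  using assms by (simp add: RP3_induced_def p3_def)

lemma continuous_map_RP3:
  assumes "continuous_map S3 Y \<phi>" and "\<And>z. z \<in> topspace S3 \<Longrightarrow> \<psi> (p3 z) = \<phi> z"
  shows "continuous_map RP3 Y \<psi>"
  by (rule continuous_compose_quotient_map[OF quotient_map_p3], rule continuous_map_eq[OF assms(1)])
    (simp add: assms(2))

lemma zpow_eq_0_iff: "n \<noteq> 0 \<Longrightarrow> zpow n z = 0 \<longleftrightarrow> z = 0"
  by (simp add: zpow_def)

lemma continuous_map_a_map:
  assumes n: "n \<noteq> 0"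
  shows "continuous_map S3 S3 (a_map n)"
proof -
  have nz: "norm (zpow n (fst z), snd z) \<noteq> 0" if "z \<in> sphere 0 1" for z
    using that n by (cases z) (auto simp: zpow_eq_0_iff zero_prod_def norm_Pair)
  have "continuous_on (sphere 0 1) (\<lambda>z :: complex \<times> complex. zpow n (fst z))"
    by (cases "n \<ge> 0") (auto simp: zpow_def intro!: continuous_intros)
  then have "continuous_on (sphere 0 1) (a_map n)"
    unfolding a_map_def[abs_def] by (intro continuous_intros ballI nz)
  moreover have "norm (a_map n z) = 1" if "z \<in> sphere 0 1" for z
    using nz[OF that] unfolding a_map_def norm_scaleR by (simp del: norm_eq_zero)
  ultimately show ?thesis by (auto simp: S3_eq_sphere)
qed

lemma h'_a'_map_fibre_circle:
  assumes n: "odd n"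
  defines "\<phi> \<equiv> h' \<circ> a'_map n"
  shows "continuous_map RP3 S2 \<phi>"
    and "subtopology RP3 {P \<in> topspace RP3. \<phi> P = y0} homeomorphic_space top_of_set (sphere (0 :: complex) 1)"
proof -
  have n0: "n \<noteq> 0" using n by auto
  have a_S3: "a_map n z \<in> topspace S3" if "z \<in> topspace S3" for z
    using continuous_map_funspace[OF continuous_map_a_map[OF n0]] that by blast
  have \<phi>: "\<phi> (p3 z) = hopf (a_map n z)" for z
    by (simp add: \<phi>_def a'_map_p3[OF n] h'_p3)
  show "continuous_map RP3 S2 \<phi>"
    using continuous_map_compose[OF continuous_map_a_map[OF n0] continuous_map_hopf]
    by (rule continuous_map_RP3) (simp add: \<phi>)
  \<comment> \<open>Squares are even functions, so they descend to \<open>RP3\<close>: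
    \<open>f\<close> will be the coordinate on the fibre, and \<open>g\<close> vanishes exactly
    where the second component does.\<close>
  define f g :: "(complex \<times> complex) set \<Rightarrow> complex"
    where "f = RP3_induced (\<lambda>z. (fst z)\<^sup>2)" and "g = RP3_induced (\<lambda>z. (snd z)\<^sup>2)"
  have fg: "f (p3 z) = (fst z)\<^sup>2" "g (p3 z) = (snd z)\<^sup>2" for z
    unfolding f_def g_def by (rule RP3_induced_p3; simp)+
  have \<phi>_iff: "\<phi> (p3 z) = y0 \<longleftrightarrow> snd z = 0" if "z \<in> topspace S3" for z
  proof -
    \<comment> \<open>The scaling factor in \<open>a_map\<close> can vanish only if the vector
      itself is 0, and then \<open>snd z = 0\<close> as well; so \<open>a_map n\<close> neither
      creates nor destroys zeros of the second component.\<close>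
    have "norm (zpow n (fst z), snd z) \<noteq> 0 \<or> snd z = 0" by (auto simp: zero_prod_def)
    then show ?thesis using a_S3[OF that] by (auto simp: \<phi> hopf_eq_y0_iff a_map_def)
  qed
  let ?A = "{P \<in> topspace RP3. \<phi> P = y0}"
  have A: "?A = p3 ` {z \<in> topspace S3. snd z = 0}"
    unfolding topspace_RP3 using \<phi>_iff by blast
  show "subtopology RP3 ?A homeomorphic_space top_of_set (sphere (0 :: complex) 1)"
  proof (rule zero_set_homeomorphic_circle[OF compact_space_RP3])
    show "continuous_map RP3 euclidean f"
      by (rule continuous_map_RP3[where \<phi> = "\<lambda>z. (fst z)\<^sup>2"])
        (auto simp: S3_eq_sphere fg intro!: continuous_intros)
    show "continuous_map RP3 euclidean g"
      by (rule continuous_map_RP3[where \<phi> = "\<lambda>z. (snd z)\<^sup>2"])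
        (auto simp: S3_eq_sphere fg intro!: continuous_intros)
    show "?A = {P \<in> topspace RP3. g P = 0}"
      unfolding A by (auto simp: topspace_RP3 fg)
    show "inj_on f ?A"
    proof (rule inj_onI, unfold A)
      fix P P' assume "P \<in> p3 ` {z \<in> topspace S3. snd z = 0}" "P' \<in> p3 ` {z \<in> topspace S3. snd z = 0}"
      then obtain a b where P: "P = p3 (a, 0)" "P' = p3 (b, 0)" by auto
      moreover assume "f P = f P'"
      ultimately have "a = b \<or> a = - b" by (simp add: fg power2_eq_iff)
      then show "P = P'" by (auto simp: P p3_def)
    qed
    show "f ` ?A = sphere 0 1"
    proof -
      have "w \<in> f ` ?A" if "cmod w = 1" for w
      proof -
        have "f (p3 (csqrt w, 0)) = w" by (simp add: fg)
        moreover have "(csqrt w, 0) \<in> topspace S3" using that by (simp add: topspace_S3)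
        ultimately show ?thesis unfolding A by force
      qed
      moreover have "cmod (f P) = 1" if "P \<in> ?A" for P
        using that unfolding A by (auto simp: fg topspace_S3 norm_power)
      ultimately show ?thesis by auto
    qed
  qed
qed

section \<open>Even indices\<close>

text \<open>The unitary matrix that moves \<open>(a, b)\<close> to \<open>(0, 1)\<close>, so off the circle over \<open>y0\<close>.\<close>

definition rot :: "complex \<Rightarrow> complex \<Rightarrow> complex \<times> complex \<Rightarrow> complex \<times> complex" where
  "rot a b z = (b * fst z - a * snd z, cnj a * fst z + cnj b * snd z)"

text \<open>The matrix of \<open>rot a b\<close> is unitary because \<open>(a, b)\<close> is a unit
  vector, and its adjoint is the matrix of \<open>rot (- a) (cnj b)\<close>.\<close>

lemma homeomorphic_maps_rot:
  assumes ab: "(a, b) \<in> topspace S3"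
  shows "homeomorphic_maps S3 S3 (rot a b) (rot (- a) (cnj b))"
proof -
  have n: "a * cnj a + b * cnj b = 1" if "(a, b) \<in> topspace S3" for a b
  proof -
    have "complex_of_real ((cmod a)\<^sup>2 + (cmod b)\<^sup>2) = 1" using that by (simp add: topspace_S3)
    then show ?thesis by (simp only: of_real_add complex_norm_square)
  qed
  have inv: "rot (- a) (cnj b) (rot a b z) = z" if "(a, b) \<in> topspace S3" for a b z
  proof -
    obtain u v where z: "z = (u, v)" by (cases z)
    have "rot (- a) (cnj b) (rot a b z) = ((a * cnj a + b * cnj b) * u, (a * cnj a + b * cnj b) * v)"
      by (simp add: rot_def z algebra_simps)
    then show ?thesis by (simp add: n[OF that] z)
  qed
  have cont: "continuous_map S3 S3 (rot a b)" if ab: "(a, b) \<in> topspace S3" for a b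
  proof -
    have "continuous_on (sphere 0 1) (rot a b)"
      unfolding rot_def[abs_def] by (intro continuous_intros)
    moreover have "norm (rot a b z) = 1" if z: "z \<in> topspace S3" for z
    proof -
      obtain u v where zuv: "z = (u, v)" by (cases z)
      have "(norm (rot a b z))\<^sup>2 = (cmod (b * u - a * v))\<^sup>2 + (cmod (cnj a * u + cnj b * v))\<^sup>2"
        by (simp add: rot_def zuv norm_Pair)
      then have "of_real ((norm (rot a b z))\<^sup>2)
          = (b * u - a * v) * cnj (b * u - a * v) + (cnj a * u + cnj b * v) * cnj (cnj a * u + cnj b * v)"
        by (simp only: of_real_add complex_norm_square)
      also have "\<dots> = (a * cnj a + b * cnj b) * (u * cnj u + v * cnj v)"
        by (simp add: algebra_simps)
      also have "\<dots> = 1" using n[OF ab] n[of u v] z by (simp add: zuv)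
      finally have "(norm (rot a b z))\<^sup>2 = 1\<^sup>2" by (simp only: of_real_eq_1_iff power_one)
      then show ?thesis by (rule power2_eq_imp_eq) simp_all
    qed
    ultimately show ?thesis by (auto simp: S3_eq_sphere)
  qed
  have ab': "(- a, cnj b) \<in> topspace S3" using ab by (simp add: topspace_S3)
  show ?thesis
    unfolding homeomorphic_maps_def
    using cont[OF ab] cont[OF ab'] inv[OF ab] inv[OF ab'] by simp
qed

lemma ex_nh_class_fibre_circle:
  assumes q: "is_q3 q" and m: "m \<noteq> 0"
  obtains f where "f \<in> nh_class m" "continuous_map RP3 S2 (f \<circ> q)"
    "subtopology RP3 {P \<in> topspace RP3. (f \<circ> q) P = y0} homeomorphic_space top_of_set (sphere (0 :: complex) 1)"
proof -
  obtain \<theta> where \<theta>: "homeomorphic_map RP3_mod_RP2 S3 \<theta>"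
    and q\<theta>: "\<And>P. P \<in> topspace RP3 \<Longrightarrow> q P = \<theta> (RP3_collapse P)"
    using q by (auto simp: is_q3_def)
  have collapse: "quotient_map RP3 RP3_mod_RP2 RP3_collapse"
    unfolding RP3_mod_RP2_def by (rule quotient_map_quotient_topology)
  have topc: "topspace RP3_mod_RP2 = RP3_collapse ` topspace RP3" by (simp add: RP3_mod_RP2_def)
  have contq: "continuous_map RP3 S3 q"
    by (rule continuous_map_eq[OF continuous_map_compose[OF quotient_imp_continuous_map[OF collapse]
      homeomorphic_imp_continuous_map[OF \<theta>]]]) (simp add: q\<theta>)
  have imq: "q ` topspace RP3 = topspace S3"
    using homeomorphic_imp_surjective_map[OF \<theta>] q\<theta> by (force simp: topc)
  \<comment> \<open>\<open>RP2\<close> is not empty, so it is a point of the quotient; its image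
    \<open>(a, b)\<close> is the only value at which \<open>q\<close> can fail to be
    injective.\<close>
  have "p3 (1, 0) \<in> RP2" by (simp add: RP2_def topspace_S3)
  moreover have RP2_sub: "RP2 \<subseteq> topspace RP3" by (auto simp: RP2_def topspace_RP3)
  ultimately have "RP2 \<in> topspace RP3_mod_RP2" by (force simp: topc RP3_collapse_def)
  then obtain a b where ab: "\<theta> RP2 = (a, b)" "(a, b) \<in> topspace S3"
    using homeomorphic_imp_surjective_map[OF \<theta>] by (metis imageI surj_pair)
  have q_inj: "P = P'" if "P \<in> topspace RP3" "P' \<in> topspace RP3" "q P = q P'" "q P \<noteq> (a, b)" for P P'
  proof -
    have "RP3_collapse P = RP3_collapse P'"
      using that homeomorphic_imp_injective_map[OF \<theta>] by (auto simp: q\<theta> topc dest: inj_onD)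
    moreover have "P \<notin> RP2" "P' \<notin> RP2" using that by (auto simp: q\<theta> RP3_collapse_def ab)
    ultimately show ?thesis by (simp add: RP3_collapse_def)
  qed
  define R where "R = rot a b"
  have R: "homeomorphic_maps S3 S3 R (rot (- a) (cnj b))"
    unfolding R_def by (rule homeomorphic_maps_rot[OF ab(2)])
  then have contR: "continuous_map S3 S3 R" by (simp add: homeomorphic_maps_def)
  have injR: "z = z'" if "z \<in> topspace S3" "z' \<in> topspace S3" "R z = R z'" for z z'
    using that R by (metis homeomorphic_maps_def)
  have imR: "R ` topspace S3 = topspace S3"
    using R homeomorphic_imp_surjective_map homeomorphic_map_maps by blast
  have Rab: "snd (R (a, b)) = 1"
  proof -
    have "complex_of_real ((cmod a)\<^sup>2 + (cmod b)\<^sup>2) = 1" using ab(2) by (simp add: topspace_S3)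
    then have "a * cnj a + b * cnj b = 1" by (simp only: of_real_add complex_norm_square)
    then show ?thesis by (simp add: R_def rot_def mult.commute)
  qed
  have degR: "S3_degree R * S3_degree R = 1"
    using S3_degree_homeomorphic_maps[OF R] by (metis abs_mult_self_eq mult_1)
  \<comment> \<open>The factor \<open>S3_degree R\<close> cancels against the degree of
    \<open>R\<close> in the composite \<open>G\<close>, which has degree \<open>m\<close> whether or
    not \<open>R\<close> preserves orientation.\<close>
  obtain w where w: "norm_preserving w" "S3_degree (map_prod w id) = m * S3_degree R"
    using ex_norm_preserving_degree[of "m * S3_degree R"] m degR by (metis mult_eq_0_iff zero_neq_one)
  define G where "G = map_prod w id \<circ> R"
  have contG: "continuous_map S3 S3 G"
    unfolding G_def by (rule continuous_map_compose[OF contR continuous_map_S3_map_prod[OF w(1)]])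
  have "S3_degree G = m"
    unfolding G_def S3_degree_compose[OF contR continuous_map_S3_map_prod[OF w(1)]] w(2)
    by (simp add: mult.assoc degR)
  then have f: "hopf \<circ> G \<in> nh_class m"
    unfolding nh_class_def homotopy_class_def
    using contG continuous_map_compose[OF contG continuous_map_hopf] by auto
  have contf: "continuous_map RP3 S2 (hopf \<circ> G \<circ> q)"
    by (intro continuous_map_compose[OF contq] continuous_map_compose[OF contG] continuous_map_hopf)
  have qS3: "q P \<in> topspace S3" if "P \<in> topspace RP3" for P using imq that by blast
  \<comment> \<open>\<open>map_prod w id\<close> leaves the second component alone, so
    \<open>w\<close> drops out of the description of the fibre.\<close>
  have iff: "(hopf \<circ> G \<circ> q) P = y0 \<longleftrightarrow> snd (R (q P)) = 0" if "P \<in> topspace RP3" for P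
  proof -
    have "G (q P) \<in> topspace S3"
      using continuous_map_funspace[OF contG] qS3[OF that] by blast
    then show ?thesis by (simp add: hopf_eq_y0_iff) (simp add: G_def)
  qed
  let ?A = "{P \<in> topspace RP3. (hopf \<circ> G \<circ> q) P = y0}"
  \<comment> \<open>The coordinate is taken from \<open>R \<circ> q\<close> and not from
    \<open>G \<circ> q\<close>, since \<open>w\<close> need not be injective. On the fibre the
    second component of \<open>R (q P)\<close> is 0, so the first one determines it; by
    \<open>Rab\<close> the value \<open>(a, b)\<close> is avoided, so \<open>P\<close> is determined
    too.\<close>
  have "subtopology RP3 ?A homeomorphic_space top_of_set (sphere (0 :: complex) 1)"
  proof (rule zero_set_homeomorphic_circle[OF compact_space_RP3])
    have "continuous_map S3 euclidean (fst :: complex \<times> complex \<Rightarrow> complex)"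
      "continuous_map S3 euclidean (snd :: complex \<times> complex \<Rightarrow> complex)"
      by (auto simp: S3_eq_sphere intro!: continuous_intros)
    then show "continuous_map RP3 euclidean (fst \<circ> (R \<circ> q))" "continuous_map RP3 euclidean (snd \<circ> (R \<circ> q))"
      using continuous_map_compose[OF continuous_map_compose[OF contq contR]] by blast+
    show "?A = {P \<in> topspace RP3. (snd \<circ> (R \<circ> q)) P = 0}" using iff by auto
    show "inj_on (fst \<circ> (R \<circ> q)) ?A"
    proof (rule inj_onI)
      fix P P' assume P: "P \<in> ?A" "P' \<in> ?A" "(fst \<circ> (R \<circ> q)) P = (fst \<circ> (R \<circ> q)) P'"
      then have "R (q P) = R (q P')" using iff by (auto simp: prod_eq_iff)
      then have "q P = q P'" using P injR qS3 by blast
      moreover have "q P \<noteq> (a, b)" using P iff Rab by force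
      ultimately show "P = P'" using P q_inj by blast
    qed
    show "(fst \<circ> (R \<circ> q)) ` ?A = sphere 0 1"
    proof -
      have "u \<in> (fst \<circ> (R \<circ> q)) ` ?A" if "cmod u = 1" for u
      proof -
        have "(u, 0) \<in> topspace S3" using that by (simp add: topspace_S3)
        then obtain P where "P \<in> topspace RP3" "R (q P) = (u, 0)"
          using imR imq by (metis imageE)
        then show ?thesis using iff by force
      qed
      moreover have "cmod (fst (R (q P))) = 1" if "P \<in> ?A" for P
      proof -
        have "R (q P) \<in> topspace S3" "snd (R (q P)) = 0"
          using that imR qS3 iff by auto
        then have "(cmod (fst (R (q P))))\<^sup>2 = 1\<^sup>2" by (simp add: topspace_S3 case_prod_beta)
        then show ?thesis by (rule power2_eq_imp_eq) simp_all
      qed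
      ultimately show ?thesis by auto
    qed
  qed
  then show ?thesis using that[OF f contf] by simp
qed

theorem theorem4p2:
  fixes n :: int and q :: "(complex \<times> complex) set \<Rightarrow> complex \<times> complex"
  assumes "is_q3 q"
    and "n \<noteq> 0"
  shows "\<exists>\<phi>. continuous_map RP3 S2 \<phi> \<and> \<phi> \<in> h'_class q n \<and>
    subtopology RP3 {P \<in> topspace RP3. \<phi> P = y0}
      homeomorphic_space top_of_set (sphere (0 :: complex) 1)"
proof (cases "odd n")
  case True
  then show ?thesis
    using h'_a'_map_fibre_circle[OF True] by (intro exI[of _ "h' \<circ> a'_map n"]) (simp add: h'_class_def homotopy_class_def)
next
  case False
  then have "n div 2 \<noteq> 0" using assms(2) by auto
  then obtain f where f: "f \<in> nh_class (n div 2)" "continuous_map RP3 S2 (f \<circ> q)"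
    "subtopology RP3 {P \<in> topspace RP3. (f \<circ> q) P = y0} homeomorphic_space top_of_set (sphere (0 :: complex) 1)"
    by (rule ex_nh_class_fibre_circle[OF assms(1)])
  then have "f \<circ> q \<in> h'_class q n"
    using False assms(2) by (force simp: h'_class_def homotopy_class_def)
  then show ?thesis using f by blast
qed

end
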